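(* For every positive even integer $K$, the explicitly defined finite set $A_K\subset\mathbb{Z}$ (constructed in the context) satisfies $$C(A_K)>\frac{2K}{K+3}.$$ Consequently, the least universal exponent is $2$; that is, the least real number $c$ such that $\sigma(A)\le\delta(A)^c$ holds for every finite set $A\subset\mathbb{Z}$ with $|A|\ge 2$ is $c=2$.
   Context: For a finite nonempty subset $A$ of an abelian group, $A+A=\{a+a':a,a'\in A\}$, $A-A=\{a-a':a,a'\in A\}$, $\sigma(A)=|A+A|/|A|$ and $\delta(A)=|A-A|/|A|$. For a finite set $A\subset\mathbb{Z}$ with $|A|\ge2$, $C(A)=\dfrac{\log\sigma(A)}{\log\delta(A)}$. Construction of $A_K$ for a positive even integer $K$. Let $W=\{0,1,2,4,5,9\}\subset\mathbb{Z}$ and, for an integer $j\ge1$, let $Y_j=\{\sum_{i=0}^{j-1}w_i12^i: w_i\in W\}\subseteq\{0,1,\dots,12^j-1\}$. Put $$s=2^K+1,\quad Q=s^2,\quad m=\frac{s-1}{2},\quad d=22(K+2),\quad n=12^d,\quad q=Qn,\quad Y=Y_d.$$ (Since $K$ is even, $\gcd(Q,n)=1$.) In $\mathbb{Z}/Q\mathbb{Z}$ define $$H=\{-m,-m+1,\dots,m\},\quad V=\{0,s,2s,\dots,(s-1)s\},\quad I=H\cup V,\quad B=I\setminus\{0\}.$$ Let $$R=\{x\in\mathbb{Z}:0\le x<q,\ x\equiv0\pmod Q\}\ \cup\ \{x\in\mathbb{Z}:0\le x<q,\ x\bmod Q\in B,\ x\bmod n\in Y\},$$ where $x\bmod Q$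 denotes the class of $x$ in $\mathbb{Z}/Q\mathbb{Z}$ and $x\bmod n$ denotes the least nonnegative residue of $x$ modulo $n$. Finally $$A_K=R\cup(R+q)=R+\{0,q\}.$$ *)

theory Defs
  imports Complex_Main "HOL-Library.Set_Algebras"
begin

(* The sumset A + A is the elementwise sum of Set_Algebras.  On sets, A - A is
   the set-theoretic difference, so the difference set needs its own name. *)
definition diffset :: "'a::ab_group_add set \<Rightarrow> 'a set" where
  "diffset A = {a - a' | a a'. a \<in> A \<and> a' \<in> A}"

definition sigma :: "'a::ab_group_add set \<Rightarrow> real" where
  "sigma A = real (card (A + A)) / real (card A)"

definition delta :: "'a::ab_group_add set \<Rightarrow> real" where
  "delta A = real (card (diffset A)) / real (card A)"

(* Meaningful only for finite A with at least two elements. *)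
definition C_exp :: "int set \<Rightarrow> real" where
  "C_exp A = ln (sigma A) / ln (delta A)"

definition universal_exponent :: "real \<Rightarrow> bool" where
  "universal_exponent c \<longleftrightarrow>
     (\<forall>A :: int set. finite A \<and> card A \<ge> 2 \<longrightarrow> sigma A \<le> delta A powr c)"

definition W_set :: "int set" where
  "W_set = {0, 1, 2, 4, 5, 9}"

definition Y_set :: "nat \<Rightarrow> int set" where
  "Y_set j = {(\<Sum>i<j. w i * 12 ^ i) | w. \<forall>i<j. w i \<in> W_set}"

definition sK :: "nat \<Rightarrow> int" where
  "sK K = 2 ^ K + 1"

definition QK :: "nat \<Rightarrow> int" where
  "QK K = (sK K)\<^sup>2"

(* Exact division: sK K is odd for K > 0. *)
definition mK :: "nat \<Rightarrow> int" where
  "mK K = (sK K - 1) div 2"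

definition dK :: "nat \<Rightarrow> nat" where
  "dK K = 22 * (K + 2)"

definition nK :: "nat \<Rightarrow> int" where
  "nK K = 12 ^ dK K"

definition qK :: "nat \<Rightarrow> int" where
  "qK K = QK K * nK K"

(* H, V, I and B are subsets of Z/QZ, each class being represented by its least
   nonnegative residue; thus the class of an integer x is x mod QK K. *)
definition HK :: "nat \<Rightarrow> int set" where
  "HK K = (\<lambda>h. h mod QK K) ` {- mK K..mK K}"

definition VK :: "nat \<Rightarrow> int set" where
  "VK K = (\<lambda>t. (t * sK K) mod QK K) ` {0..sK K - 1}"

definition IK :: "nat \<Rightarrow> int set" where
  "IK K = HK K \<union> VK K"

definition BK :: "nat \<Rightarrow> int set" where
  "BK K = IK K - {0}"

definition RK :: "nat \<Rightarrow> int set" where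
  "RK K = {x. 0 \<le> x \<and> x < qK K \<and> x mod QK K = 0} \<union>
         {x. 0 \<le> x \<and> x < qK K \<and> x mod QK K \<in> BK K \<and> x mod nK K \<in> Y_set (dK K)}"

definition AK :: "nat \<Rightarrow> int set" where
  "AK K = RK K + {0, qK K}"

lemma finite_AK: "finite (AK K)"
proof -
  have "RK K \<subseteq> {0..<qK K}"
    by (auto simp: RK_def)
  then have "finite (RK K)"
    by (rule finite_subset) simp
  then show ?thesis
    by (simp add: AK_def finite_set_plus)
qed

lemma card_AK_ge_2: "card (AK K) \<ge> 2"
proof -
  have "(0::int) < 2 ^ K + 1"
    by (simp add: add_pos_pos)
  then have q_pos: "0 < qK K"
    unfolding qK_def QK_def sK_def nK_def by (intro mult_pos_pos zero_less_power) auto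
  then have "0 \<in> RK K"
    by (simp add: RK_def)
  then have "{0, qK K} \<subseteq> AK K"
    unfolding AK_def using set_plus_intro[of 0 "RK K" 0 "{0, qK K}"]
      set_plus_intro[of 0 "RK K" "qK K" "{0, qK K}"] by simp
  moreover have "card {0, qK K} = 2"
    using q_pos by simp
  ultimately show ?thesis
    using card_mono[OF finite_AK] by metis
qed

end

theory Submission
  imports Defs "HOL-Number_Theory.Cong" "HOL-Real_Asymp.Real_Asymp"
begin

text \<open>
  The upper bound 2 on the exponent is the Pluennecke--Ruzsa argument in Petridis' form, applied with
  \<open>X \<subseteq> A\<close> minimising \<open>|X - A| / |X|\<close>:
  \<open>|A + A| \<le> |X - A - A| \<le> \<delta>\<^sup>2 |X|\<close>.

  For the lower bound, \<open>A\<close> is dominated by the \<open>2 n\<close> multiples of \<open>Q\<close>. Every residue modulo \<open>Q\<close> outside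
  \<open>I\<close> is a sum of two elements of \<open>B\<close>, and the digit set \<open>W\<close> satisfies \<open>W + W = \<int>/12\<close>, so
  \<open>R + R\<close> covers \<open>\<int>/q\<close> and \<open>\<sigma> \<ge> Q > 4^K\<close>. In \<open>A - A\<close> only the few residues in \<open>I\<close>
  carry full fibres; over the others the fibre lies in \<open>Y - Y\<close>, whose density modulo \<open>12^d\<close> is
  exponentially small in \<open>d\<close> because 6 is not a difference of \<open>W\<close> modulo 12. This gives
  \<open>\<delta> < 2^(K + 3)\<close>.
\<close>

section \<open>Petridis' inequality and the exponent 2\<close>

text \<open>Induction on \<open>C\<close>. When \<open>c\<close> is added, \<open>Z\<close> collects
  the \<open>x\<close> in \<open>X\<close> with \<open>x + c\<close> already in
  \<open>X + C\<close>. Then \<open>X + C\<close> gains exactly |X| - |Z| points. The translate of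
  \<open>Z + B\<close> by \<open>c\<close> already lies in \<open>X + B + C\<close>, so that set
  gains at most |X + B| - |Z + B| points, and by minimality this is at most \<kappa> times |X| -
  |Z|.\<close>

lemma petridis_inequality:
  fixes X B C :: "'a::ab_group_add set"
  assumes "finite X" "finite B" "finite C"
    and min: "\<And>Z. Z \<subseteq> X \<Longrightarrow> \<kappa> * real (card Z) \<le> real (card (Z + B))"
    and X: "real (card (X + B)) = \<kappa> * real (card X)"
  shows "real (card (X + B + C)) \<le> \<kappa> * real (card (X + C))"
  using \<open>finite C\<close>
proof (induction C rule: finite_induct)
  case empty
  then show ?case by (simp add: set_plus_def)
next
  case (insert c C)
  define Z where "Z = {x \<in> X. x + c \<in> X + C}"
  have ZX: "Z \<subseteq> X" by (auto simp: Z_def)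
  have fin: "finite Z" "finite (X + B)" "finite (Z + B)" "finite (X + C)" "finite (X + B + C)"
    using assms(1,2) insert ZX by (auto intro!: finite_set_plus elim: finite_subset)
  have inj: "inj_on (\<lambda>x. x + c) S" for S by (simp add: inj_on_def)
  have "X + insert c C = (X + C) \<union> (\<lambda>x. x + c) ` (X - Z)"
    unfolding Z_def set_plus_def by blast
  also have "card \<dots> = card (X + C) + card ((\<lambda>x. x + c) ` (X - Z))"
    using fin assms(1) by (intro card_Un_disjoint) (auto simp: Z_def)
  also have "card ((\<lambda>x. x + c) ` (X - Z)) = card X - card Z"
    using inj fin ZX by (simp add: card_image card_Diff_subset)
  finally have 1: "real (card (X + insert c C)) = real (card (X + C)) + real (card X) - real (card Z)"
    using card_mono[OF assms(1) ZX] by simp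
  have ZB: "Z + B \<subseteq> X + B" using ZX by (auto simp: set_plus_def)
  have "X + B + insert c C \<subseteq> (X + B + C) \<union> (\<lambda>x. x + c) ` ((X + B) - (Z + B))"
  proof
    fix u assume "u \<in> X + B + insert c C"
    then obtain x b c' where u: "u = x + b + c'" "x \<in> X" "b \<in> B" "c' = c \<or> c' \<in> C"
      by (auto simp: set_plus_def)
    show "u \<in> (X + B + C) \<union> (\<lambda>x. x + c) ` ((X + B) - (Z + B))"
    proof (cases "c' \<in> C")
      case True
      then show ?thesis using u by (auto intro: set_plus_intro)
    next
      case False
      then have c': "c' = c" using u by simp
      show ?thesis
      proof (cases "x + b \<in> Z + B")
        case True
        then obtain z b' where z: "x + b = z + b'" "z \<in> Z" "b' \<in> B" by (auto simp: set_plus_def)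
        then obtain x' c'' where x': "z + c = x' + c''" "x' \<in> X" "c'' \<in> C"
          by (auto simp: Z_def set_plus_def)
        have "u = z + c + b'" using u(1) z(1) c' by (simp add: ac_simps)
        also have "\<dots> = x' + b' + c''" using x'(1) by (simp add: ac_simps)
        finally show ?thesis using x' z by (auto intro: set_plus_intro)
      next
        case False
        then show ?thesis using u c' by (auto intro: set_plus_intro)
      qed
    qed
  qed
  then have "card (X + B + insert c C) \<le> card ((X + B + C) \<union> (\<lambda>x. x + c) ` ((X + B) - (Z + B)))"
    using fin by (intro card_mono) auto
  also have "\<dots> \<le> card (X + B + C) + card ((\<lambda>x. x + c) ` ((X + B) - (Z + B)))"
    by (rule card_Un_le)
  also have "card ((\<lambda>x. x + c) ` ((X + B) - (Z + B))) = card (X + B) - card (Z + B)"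
    using inj fin ZB by (simp add: card_image card_Diff_subset)
  finally have "real (card (X + B + insert c C))
      \<le> real (card (X + B + C)) + real (card (X + B)) - real (card (Z + B))"
    using card_mono[OF fin(2) ZB] by linarith
  also have "\<dots> \<le> \<kappa> * real (card (X + C)) + \<kappa> * real (card X) - \<kappa> * real (card Z)"
    using insert.IH X min[OF ZX] by linarith
  also have "\<dots> = \<kappa> * real (card (X + insert c C))"
    unfolding 1 by (simp add: algebra_simps)
  finally show ?case .
qed

lemma diffset_eq_plus_uminus: "diffset A = A + uminus ` A"
  unfolding diffset_def set_plus_def by force

lemma card_le_card_plus_left:
  fixes X C :: "'a::ab_group_add set"
  assumes "finite X" "finite C" "X \<noteq> {}"
  shows "card C \<le> card (X + C)"
proof -
  obtain x where "x \<in> X" using assms by blast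
  then have "(\<lambda>c. x + c) ` C \<subseteq> X + C" by (auto intro: set_plus_intro)
  moreover have "card ((\<lambda>c. x + c) ` C) = card C" by (intro card_image) (simp add: inj_on_def)
  ultimately show ?thesis using card_mono[OF finite_set_plus[OF assms(1,2)]] by metis
qed

text \<open>Petridis' inequality is used with both \<open>B\<close> and \<open>C\<close> equal to
  -A. Comparing the minimiser \<open>X\<close> with \<open>A\<close> itself gives
  \<open>\<rho> X \<le> delta A\<close>, and \<open>A + A\<close> is the negative of
  \<open>B + B\<close>, a translate of which lies in \<open>X + B + B\<close>.\<close>

lemma sigma_le_delta_square:
  fixes A :: "'a::ab_group_add set"
  assumes "finite A" "A \<noteq> {}"
  shows "sigma A \<le> (delta A)\<^sup>2"
proof -
  define B where "B = uminus ` A"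
  define \<rho> where "\<rho> = (\<lambda>Z. real (card (Z + B)) / real (card Z))"
  have finB: "finite B" using assms by (simp add: B_def)
  have "finite (Pow A - {{}})" "Pow A - {{}} \<noteq> {}" using assms by auto
  then obtain X where X: "X \<in> Pow A - {{}}" and le: "\<And>Z. Z \<in> Pow A - {{}} \<Longrightarrow> \<rho> X \<le> \<rho> Z"
    using arg_min_if_finite[of "Pow A - {{}}" \<rho>] by (metis not_less)
  have fX: "finite X" and X0: "X \<noteq> {}" "X \<subseteq> A" using X assms by (auto intro: finite_subset)
  have cX: "card X > 0" using fX X0 by (simp add: card_gt_0_iff)
  have cA: "card A > 0" using assms by (simp add: card_gt_0_iff)
  have \<rho>\<delta>: "\<rho> X \<le> delta A"
    using le[of A] assms by (simp add: \<rho>_def delta_def diffset_eq_plus_uminus B_def)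
  have \<rho>0: "\<rho> X \<ge> 0" by (simp add: \<rho>_def)
  have min: "\<rho> X * real (card Z) \<le> real (card (Z + B))" if "Z \<subseteq> X" for Z
  proof (cases "Z = {}")
    case False
    have "finite Z" using that fX finite_subset by blast
    then have "card Z > 0" using False by (simp add: card_gt_0_iff)
    moreover have "\<rho> X \<le> \<rho> Z" using le that X0 False by auto
    ultimately show ?thesis by (simp add: \<rho>_def pos_le_divide_eq)
  qed simp
  have eq: "real (card (X + B)) = \<rho> X * real (card X)" using cX by (simp add: \<rho>_def)
  have "B + B = uminus ` (A + A)"
    unfolding B_def set_plus_def by (force simp: image_iff)
  then have "card (A + A) = card (B + B)"
    by (simp add: card_image)
  also have "\<dots> \<le> card (X + (B + B))"
    using fX X0 finB by (intro card_le_card_plus_left finite_set_plus) auto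
  finally have "real (card (A + A)) \<le> real (card (X + B + B))"
    by (simp add: add.assoc)
  also have "\<dots> \<le> \<rho> X * real (card (X + B))"
    by (rule petridis_inequality[OF fX finB finB min eq])
  also have "\<dots> = (\<rho> X)\<^sup>2 * real (card X)" by (simp add: eq power2_eq_square)
  also have "\<dots> \<le> (delta A)\<^sup>2 * real (card A)"
    using \<rho>\<delta> \<rho>0 X0 assms by (intro mult_mono power_mono) (auto intro: card_mono)
  finally show ?thesis using cA by (simp add: sigma_def pos_divide_le_eq)
qed

lemma delta_ge_1:
  fixes A :: "'a::ab_group_add set"
  assumes "finite A" "A \<noteq> {}"
  shows "delta A \<ge> 1"
proof -
  have "finite (uminus ` A)" using assms by simp
  then have "card (uminus ` A) \<le> card (diffset A)"
    unfolding diffset_eq_plus_uminus using assms by (intro card_le_card_plus_left)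
  then have "card A \<le> card (diffset A)" by (simp add: card_image)
  moreover have "card A > 0" using assms by (simp add: card_gt_0_iff)
  ultimately show ?thesis by (simp add: delta_def)
qed

lemma universal_exponent_2: "universal_exponent 2"
  unfolding universal_exponent_def
proof (intro allI impI)
  fix A :: "int set" assume A: "finite A \<and> card A \<ge> 2"
  then have "A \<noteq> {}" by auto
  then have "delta A \<ge> 1" "sigma A \<le> (delta A)\<^sup>2"
    using A delta_ge_1 sigma_le_delta_square by blast+
  then show "sigma A \<le> delta A powr 2"
    by (simp add: powr_numeral)
qed

section \<open>Sums and differences of the digit set\<close>

lemma Y_set_0: "Y_set 0 = {0}"
  by (auto simp: Y_set_def)

lemma Y_set_Suc: "Y_set (Suc j) = {y + 12 ^ j * w | y w. y \<in> Y_set j \<and> w \<in> W_set}"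
proof (intro equalityI subsetI)
  fix x assume "x \<in> Y_set (Suc j)"
  then obtain w where "x = (\<Sum>i<Suc j. w i * 12 ^ i)" "\<forall>i<Suc j. w i \<in> W_set"
    by (auto simp: Y_set_def)
  then have "x = (\<Sum>i<j. w i * 12 ^ i) + 12 ^ j * w j" "(\<Sum>i<j. w i * 12 ^ i) \<in> Y_set j"
    "w j \<in> W_set"
    by (auto simp: Y_set_def)
  then show "x \<in> {y + 12 ^ j * w | y w. y \<in> Y_set j \<and> w \<in> W_set}" by blast
next
  fix x assume "x \<in> {y + 12 ^ j * w | y w. y \<in> Y_set j \<and> w \<in> W_set}"
  then obtain u w where x: "x = (\<Sum>i<j. u i * 12 ^ i) + 12 ^ j * w" "\<forall>i<j. u i \<in> W_set" "w \<in> W_set"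
    by (auto simp: Y_set_def)
  then have "x = (\<Sum>i<Suc j. (u(j := w)) i * 12 ^ i)" by simp
  moreover have "\<forall>i<Suc j. (u(j := w)) i \<in> W_set" using x by (simp add: less_Suc_eq)
  ultimately show "x \<in> Y_set (Suc j)" unfolding Y_set_def by blast
qed

lemma Y_set_bounds: "y \<in> Y_set j \<Longrightarrow> 0 \<le> y \<and> y < 12 ^ j"
proof (induction j arbitrary: y)
  case 0
  then show ?case by (simp add: Y_set_0)
next
  case (Suc j)
  then obtain u w where u: "y = u + 12 ^ j * w" "u \<in> Y_set j" and w: "w \<in> W_set"
    by (auto simp: Y_set_Suc)
  have "0 \<le> w" "w \<le> 9" using w by (auto simp: W_set_def)
  then have "0 \<le> 12 ^ j * w" "12 ^ j * w \<le> 12 ^ j * (9::int)" by (auto intro: mult_left_mono)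
  moreover have "0 \<le> u" "u < 12 ^ j" using Suc.IH[OF u(2)] by auto
  ultimately show ?case using u(1) unfolding power_Suc by linarith
qed

lemma card_Y_set: "finite (Y_set j) \<and> card (Y_set j) \<le> 6 ^ j"
proof (induction j)
  case 0
  then show ?case by (simp add: Y_set_0)
next
  case (Suc j)
  have eq: "Y_set (Suc j) = (\<lambda>(y, w). y + 12 ^ j * w) ` (Y_set j \<times> W_set)"
    by (force simp: Y_set_Suc)
  have W: "finite W_set" "card W_set = 6" by (simp_all add: W_set_def)
  have "card (Y_set (Suc j)) \<le> card (Y_set j \<times> W_set)"
    unfolding eq using Suc W by (intro card_image_le) simp
  also have "\<dots> \<le> 6 ^ Suc j" using Suc W by (simp add: card_cartesian_product)
  finally show ?case unfolding eq using Suc W by simp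
qed

text \<open>Digits are chosen from the lowest up. After \<open>j\<close> digits the quotient
  \<open>k\<close> has absorbed all carries, and the next pair of digits only has to match
  \<open>k\<close> modulo 12, which is possible because W + W meets every class modulo 12.\<close>

lemma Y_set_sum_cover: "\<exists>y\<in>Y_set j. \<exists>y'\<in>Y_set j. 12 ^ j dvd x - (y + y')"
proof (induction j)
  case 0
  then show ?case by (simp add: Y_set_0)
next
  case (Suc j)
  then obtain y y' k where y: "y \<in> Y_set j" "y' \<in> Y_set j" and k: "x - (y + y') = 12 ^ j * k"
    by (auto elim!: dvdE)
  have "\<exists>w\<in>W_set. \<exists>w'\<in>W_set. 12 dvd k - (w + w')"
    unfolding W_set_def by (simp, presburger)
  then obtain w w' l where w: "w \<in> W_set" "w' \<in> W_set" and l: "k - (w + w') = 12 * l"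
    by (auto elim!: dvdE)
  have "x - ((y + 12 ^ j * w) + (y' + 12 ^ j * w')) = 12 ^ j * (k - (w + w'))"
    using k by (simp add: algebra_simps)
  also have "\<dots> = 12 ^ Suc j * l" by (simp add: l)
  finally have "12 ^ Suc j dvd x - ((y + 12 ^ j * w) + (y' + 12 ^ j * w'))" by simp
  moreover have "y + 12 ^ j * w \<in> Y_set (Suc j)" "y' + 12 ^ j * w' \<in> Y_set (Suc j)"
    using y w by (auto simp: Y_set_Suc)
  ultimately show ?case by blast
qed

text \<open>Modulo 12 only the class of 6 is missing. The differences are listed as integers, not as
  classes, since the borrow count below distinguishes \<open>e\<close> from
  \<open>e - 12\<close>.\<close>

lemma diffset_W_set:
  "diffset W_set = {0, 1, 2, 3, 4, 5, 7, 8, 9, -1, -2, -3, -4, -5, -7, -8, -9}"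
proof -
  have "diffset W_set = (\<lambda>(a, b). a - b) ` (W_set \<times> W_set)"
    by (force simp: diffset_def)
  also have "\<dots> = {0, 1, 2, 3, 4, 5, 7, 8, 9, -1, -2, -3, -4, -5, -7, -8, -9}"
    unfolding W_set_def by (simp add: insert_Times_insert) auto
  finally show ?thesis .
qed

text \<open>
  A residue \<open>y\<close> modulo \<open>12^j\<close> has two candidate representatives in \<open>Y - Y\<close>, namely \<open>y\<close> and
  \<open>y - 12^j\<close>; the second one borrows 1 from the next digit.
\<close>
lemma diffset_Y_set_Suc:
  assumes y: "0 \<le> y" "y < 12 ^ j" and mem: "y + 12 ^ j * e \<in> diffset (Y_set (Suc j))"
  shows "e \<in> diffset W_set \<and> y \<in> diffset (Y_set j) \<or>
    e + 1 \<in> diffset W_set \<and> y - 12 ^ j \<in> diffset (Y_set j)"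
proof -
  obtain u u' w w' where u: "u \<in> Y_set j" "u' \<in> Y_set j" and w: "w \<in> W_set" "w' \<in> W_set"
    and eq: "y + 12 ^ j * e = u + 12 ^ j * w - (u' + 12 ^ j * w')"
    using mem by (auto simp: diffset_def Y_set_Suc)
  \<comment> \<open>\<open>z\<close> is the borrow from the digit \<open>e\<close>. The ranges of
    \<open>y\<close> and \<open>u - u'\<close> leave only the values 0 and 1.\<close>
  define z where "z = w - w' - e"
  have e: "y = u - u' + 12 ^ j * z" using eq by (simp add: z_def algebra_simps)
  have b: "- (12 ^ j) < u - u'" "u - u' < 12 ^ j"
    using Y_set_bounds[OF u(1)] Y_set_bounds[OF u(2)] by linarith+
  have "12 ^ j * z < 12 ^ j * 2" using e b y by linarith
  then have "z < 2" by simp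
  moreover have "12 ^ j * (- 1) < 12 ^ j * z" using e b y by linarith
  then have "- 1 < z" by (simp only: mult_less_cancel_left_pos zero_less_power zero_less_numeral)
  ultimately have "z = 0 \<or> z = 1" by linarith
  moreover have "u - u' \<in> diffset (Y_set j)" "w - w' \<in> diffset W_set"
    using u w by (auto simp: diffset_def)
  ultimately show ?thesis
  proof (elim disjE)
    assume "z = 0"
    then have "y = u - u'" "e = w - w'" using e by (auto simp: z_def)
    then show ?thesis using \<open>u - u' \<in> _\<close> \<open>w - w' \<in> _\<close> by simp
  next
    assume "z = 1"
    then have "y - 12 ^ j = u - u'" "e + 1 = w - w'" using e by (auto simp: z_def)
    then show ?thesis using \<open>u - u' \<in> _\<close> \<open>w - w' \<in> _\<close> by simp
  qed
qed

text \<open>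
  Let \<open>u\<close> and \<open>c\<close> count the residues for which exactly one, respectively both, of the two
  representatives lie in \<open>Y - Y\<close>. Appending a digit maps \<open>(u, c)\<close> to at most
  \<open>(5u + 4c, 6u + 8c)\<close>, a matrix with largest eigenvalue \<open>(13 + sqrt 105) / 2 < 93 / 8\<close>. The weights
  \<open>(29, 32)\<close> approximate its left eigenvector, so that \<open>29u + 32c\<close> grows by at most \<open>93 / 8\<close>.
\<close>
definition weight :: "bool \<Rightarrow> bool \<Rightarrow> real" where
  "weight p q = (if p \<and> q then 32 else if p \<or> q then 29 else 0)"

definition residue_weight :: "nat \<Rightarrow> int \<Rightarrow> real" where
  "residue_weight j x = weight (x \<in> diffset (Y_set j)) (x - 12 ^ j \<in> diffset (Y_set j))"

text \<open>A finite check over the top digit. If \<open>y\<close> has one representative, 5 digits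
  yield one representative and 6 yield both, of weight 5 * 29 + 6 * 32 = 337 < 29 * 93 / 8. If it
  has both, the counts are 4 and 8, of weight 372 = 32 * 93 / 8 exactly.\<close>

lemma residue_weight_step:
  assumes "0 \<le> y" "y < 12 ^ j"
  shows "(\<Sum>e\<in>{0..<12}. residue_weight (Suc j) (y + 12 ^ j * e)) \<le> 93 / 8 * residue_weight j y"
proof -
  define P where "P = (y \<in> diffset (Y_set j))"
  define N where "N = (y - 12 ^ j \<in> diffset (Y_set j))"
  define f where "f = (\<lambda>e. e \<in> diffset W_set \<and> P \<or> e + 1 \<in> diffset W_set \<and> N)"
  have f: "f e" if "y + 12 ^ j * e \<in> diffset (Y_set (Suc j))" for e
    using diffset_Y_set_Suc[OF assms that] by (simp add: f_def P_def N_def)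
  have mono: "weight p q \<le> weight p' q'" if "p \<longrightarrow> p'" "q \<longrightarrow> q'" for p q p' q'
    using that by (simp add: weight_def)
  have "residue_weight (Suc j) (y + 12 ^ j * e) \<le> weight (f e) (f (e - 12))" for e
  proof -
    \<comment> \<open>The second representative is the same lower part \<open>y\<close> under the
      top digit \<open>e - 12\<close>, so a single predicate \<open>f\<close> governs both.\<close>
    have "y + 12 ^ j * e - 12 ^ Suc j = y + 12 ^ j * (e - 12)" by (simp add: algebra_simps)
    then have "f (e - 12)" if "y + 12 ^ j * e - 12 ^ Suc j \<in> diffset (Y_set (Suc j))"
      using f that by metis
    then show ?thesis unfolding residue_weight_def using f by (intro mono) blast+
  qed
  then have "(\<Sum>e\<in>{0..<12}. residue_weight (Suc j) (y + 12 ^ j * e))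
      \<le> (\<Sum>e\<in>{0..<12}. weight (f e) (f (e - 12)))"
    by (intro sum_mono)
  also have "\<dots> \<le> 93 / 8 * weight P N"
  proof -
    have "{0..<12} = {0, 1, 2, 3, 4, 5, 6, 7, 8, 9, 10, 11::int}" by (auto; presburger)
    then show ?thesis
      unfolding f_def diffset_W_set by (cases P; cases N) (simp_all add: weight_def)
  qed
  finally show ?thesis by (simp add: residue_weight_def P_def N_def)
qed

lemma div_less_of_less_mult:
  fixes x M N :: int
  assumes "M > 0" "x < M * N"
  shows "x div M < N"
proof -
  have "M * (x div M) < M * N"
    using assms mult_div_mod_eq[of M x] pos_mod_sign[of M x] by linarith
  then show ?thesis using assms(1) by simp
qed

text \<open>Splitting off the top digit turns the one-step bound into geometric growth. The initial
  value is 29 because \<open>Y_set 0\<close> has 0 as a difference but not -1.\<close>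

lemma residue_weight_sum: "(\<Sum>x\<in>{0..<12 ^ j}. residue_weight j x) \<le> 29 * (93 / 8) ^ j"
proof (induction j)
  case 0
  have "{0..<1} = {0::int}" by auto
  then show ?case by (simp add: residue_weight_def weight_def Y_set_0 diffset_def)
next
  case (Suc j)
  have "(\<Sum>x\<in>{0..<12 ^ Suc j}. residue_weight (Suc j) x)
      = (\<Sum>(y, e)\<in>{0..<12 ^ j} \<times> {0..<12}. residue_weight (Suc j) (y + 12 ^ j * e))"
  proof (rule sum.reindex_bij_witness[where i = "\<lambda>(y, e). y + 12 ^ j * e"
        and j = "\<lambda>x. (x mod 12 ^ j, x div 12 ^ j)"], goal_cases)
    case (2 x)
    then have "x div 12 ^ j < 12"
      by (intro div_less_of_less_mult) auto
    then show ?case using 2 by (auto simp: pos_imp_zdiv_nonneg_iff)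
  next
    case (4 p)
    then obtain y e where p: "p = (y, e)" "0 \<le> y" "y < 12 ^ j" "0 \<le> e" "e \<le> 11" by auto
    then have "12 ^ j * e \<le> 12 ^ j * (11::int)" by (intro mult_left_mono) auto
    then have "y + 12 ^ j * e < 12 ^ Suc j" using p unfolding power_Suc by linarith
    then show ?case using p by simp
  qed (auto simp: div_pos_pos_trivial)
  also have "\<dots> = (\<Sum>y\<in>{0..<12 ^ j}. \<Sum>e\<in>{0..<12}. residue_weight (Suc j) (y + 12 ^ j * e))"
    by (simp add: sum.cartesian_product)
  also have "\<dots> \<le> (\<Sum>y\<in>{0..<12 ^ j}. 93 / 8 * residue_weight j y)"
    by (intro sum_mono residue_weight_step) auto
  also have "\<dots> \<le> 29 * (93 / 8) ^ Suc j"
    unfolding sum_distrib_left[symmetric] using Suc by simp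
  finally show ?case .
qed

text \<open>Each class met by Y - Y has at least one representative and so weighs at least 29, which
  cancels the initial value 29 of the total weight.\<close>

lemma card_diffset_Y_set_mod:
  "real (card ((\<lambda>x. x mod 12 ^ j) ` diffset (Y_set j))) \<le> (93 / 8) ^ j" (is "real (card ?D) \<le> _")
proof -
  have sub: "?D \<subseteq> {0..<12 ^ j}" by auto
  have "29 \<le> residue_weight j x" if x_D: "x \<in> ?D" for x
  proof -
    obtain d where "d \<in> diffset (Y_set j)" and d: "x = d mod 12 ^ j"
      using x_D by blast
    then obtain y y' where y: "y \<in> Y_set j" "y' \<in> Y_set j" and x: "x = (y - y') mod 12 ^ j"
      unfolding diffset_def by blast
    have b: "- (12 ^ j) < y - y'" "y - y' < 12 ^ j"
      using Y_set_bounds[OF y(1)] Y_set_bounds[OF y(2)] by linarith+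
    have "x = y - y' \<or> x - 12 ^ j = y - y'"
    proof (cases "0 \<le> y - y'")
      case True
      then show ?thesis using b x by simp
    next
      case False
      have "x = (y - y' + 12 ^ j) mod 12 ^ j" unfolding x by simp
      also have "\<dots> = y - y' + 12 ^ j" using False b by (intro mod_pos_pos_trivial) auto
      finally show ?thesis by simp
    qed
    then have "x \<in> diffset (Y_set j) \<or> x - 12 ^ j \<in> diffset (Y_set j)"
      using y by (auto simp: diffset_def)
    then show ?thesis by (auto simp: residue_weight_def weight_def)
  qed
  then have "(\<Sum>x\<in>?D. 29) \<le> (\<Sum>x\<in>?D. residue_weight j x)" by (intro sum_mono)
  also have "\<dots> \<le> (\<Sum>x\<in>{0..<12 ^ j}. residue_weight j x)"
    using sub by (intro sum_mono2) (auto simp: residue_weight_def weight_def)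
  also have "\<dots> \<le> 29 * (93 / 8) ^ j" by (rule residue_weight_sum)
  finally show ?thesis by simp
qed

text \<open>Each class modulo \<open>M\<close> has \<open>N\<close> representatives below
  \<open>M * N\<close>. This counts unions of fibres over classes modulo \<open>Q\<close> and, with
  the roles exchanged, modulo \<open>n\<close>.\<close>

lemma card_residues_le:
  fixes M N :: int
  assumes "M > 0" "N > 0" "finite S"
  shows "int (card {x. 0 \<le> x \<and> x < M * N \<and> x mod M \<in> S}) \<le> int (card S) * N"
proof -
  have "{x. 0 \<le> x \<and> x < M * N \<and> x mod M \<in> S} \<subseteq> (\<lambda>(r, t). r + M * t) ` (S \<times> {0..<N})"
  proof
    fix x assume x: "x \<in> {x. 0 \<le> x \<and> x < M * N \<and> x mod M \<in> S}"
    then have "x div M < N" "0 \<le> x div M"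
      using assms by (auto simp: pos_imp_zdiv_nonneg_iff intro: div_less_of_less_mult)
    moreover have "x = x mod M + M * (x div M)" by simp
    ultimately show "x \<in> (\<lambda>(r, t). r + M * t) ` (S \<times> {0..<N})" using x
      by (intro image_eqI[of _ _ "(x mod M, x div M)"]) auto
  qed
  then have "card {x. 0 \<le> x \<and> x < M * N \<and> x mod M \<in> S} \<le> card (S \<times> {0..<N})"
    using assms by (intro surj_card_le) auto
  then have "card {x. 0 \<le> x \<and> x < M * N \<and> x mod M \<in> S} \<le> card S * nat N"
    by (simp add: card_cartesian_product)
  then have "int (card {x. 0 \<le> x \<and> x < M * N \<and> x mod M \<in> S}) \<le> int (card S * nat N)"
    by (simp only: of_nat_le_iff)
  then show ?thesis using assms by simp
qed


section \<open>Sumset and difference set of the construction\<close>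

context
  fixes K :: nat
  assumes K_pos: "0 < K" and K_even: "even K"
begin

private definition s :: int where "s = sK K"
private definition m :: int where "m = mK K"
private definition Q :: int where "Q = QK K"
private definition n :: int where "n = nK K"
private definition q :: int where "q = qK K"
private definition Y :: "int set" where "Y = Y_set (dK K)"
private definition I :: "int set" where "I = IK K"
private definition R :: "int set" where "R = RK K"
private definition A :: "int set" where "A = AK K"

section \<open>Arithmetic of the parameters\<close>

private lemma s_pos: "s > 0"
  by (simp add: s_def sK_def add_pos_pos)

private lemma s_eq: "s = 2 * m + 1"
proof -
  have "even (2 ^ K :: int)" using K_pos by simp
  then show ?thesis by (simp add: s_def m_def sK_def mK_def)
qed

private lemma Q_eq: "Q = s * s"
  by (simp add: Q_def QK_def s_def power2_eq_square)

private lemma Q_pos: "Q > 0"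
  using s_pos by (simp add: Q_eq)

private lemma n_eq: "n = 12 ^ dK K"
  by (simp add: n_def nK_def)

private lemma n_pos: "n > 0"
  by (simp add: n_eq)

private lemma q_eq: "q = Q * n"
  by (simp add: q_def qK_def Q_def n_def)

private lemma q_pos: "q > 0"
  using Q_pos n_pos by (simp add: q_eq)

text \<open>Evenness of \<open>K\<close> gives \<open>2 ^ K\<close> = 1 modulo 3, hence
  \<open>s\<close> = 2 modulo 3; also \<open>s\<close> is odd, so it shares no prime factor with
  12.\<close>

private lemma coprime_Q_n: "coprime Q n"
proof -
  obtain k where k: "K = 2 * k" using K_even by blast
  have "[4 ^ k = 1 ^ k] (mod (3::int))" by (intro cong_pow) (simp add: Cong.cong_def)
  then have "(2::int) ^ K mod 3 = 1" by (simp add: Cong.cong_def k power_mult)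
  then have s3: "s mod 3 = 2" unfolding s_def sK_def by presburger
  have "coprime (s mod 3) 3" unfolding s3 by simp
  then have "coprime s 3" by simp
  moreover have "coprime s 2" using s_eq by simp
  ultimately have "coprime s (2 * 2 * 3)" by (simp only: coprime_mult_right_iff)
  then have "coprime s 12" by simp
  then show ?thesis unfolding Q_eq n_eq by simp
qed

section \<open>The residue set I modulo Q\<close>

private lemma mem_I_iff: "x mod Q \<in> I \<longleftrightarrow> (\<exists>h\<in>{-m..m}. Q dvd x - h) \<or> s dvd x"
proof -
  have "x mod Q \<in> HK K \<longleftrightarrow> (\<exists>h\<in>{-m..m}. Q dvd x - h)"
    by (auto simp: HK_def image_iff mod_eq_dvd_iff simp flip: Q_def m_def)
  moreover have "x mod Q \<in> VK K \<longleftrightarrow> s dvd x"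
  proof
    assume "x mod Q \<in> VK K"
    then obtain t where "Q dvd x - t * s"
      by (auto simp: VK_def image_iff mod_eq_dvd_iff simp flip: Q_def s_def)
    then have "s dvd x - t * s" unfolding Q_eq by (rule dvd_mult_left)
    then show "s dvd x" by (metis diff_add_cancel dvd_add dvd_triv_right)
  next
    assume "s dvd x"
    then obtain k where k: "x = s * k" ..
    \<comment> \<open>As \<open>Q = s * s\<close>, the class of \<open>s * k\<close> modulo
      \<open>Q\<close> depends only on \<open>k mod s\<close>.\<close>
    have "x - (k mod s) * s = Q * (k div s)"
      unfolding k Q_eq by (simp add: minus_mod_eq_mult_div [symmetric] algebra_simps)
    then have "x mod Q = ((k mod s) * s) mod Q" by (simp add: mod_eq_dvd_iff)
    moreover have "k mod s \<in> {0..s - 1}" using s_pos by simp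
    ultimately show "x mod Q \<in> VK K"
      unfolding VK_def Q_def[symmetric] s_def[symmetric] by blast
  qed
  ultimately show ?thesis by (simp add: I_def IK_def)
qed

private lemma I_uminus: "x mod Q \<in> I \<Longrightarrow> (- x) mod Q \<in> I"
proof -
  assume "x mod Q \<in> I"
  then consider h where "h \<in> {-m..m}" "Q dvd x - h" | "s dvd x" by (auto simp: mem_I_iff)
  then show "(- x) mod Q \<in> I"
  proof cases
    case 1
    then have "- h \<in> {-m..m}" "Q dvd - x - - h"
      by (auto simp: dvd_diff_commute)
    then show ?thesis unfolding mem_I_iff by blast
  qed (simp add: mem_I_iff)
qed

private lemma finite_I: "finite I"
  by (simp add: I_def IK_def HK_def VK_def)

private lemma card_I: "int (card I) \<le> 2 * s"
proof -
  have "card I \<le> card (HK K) + card (VK K)" by (simp add: I_def IK_def card_Un_le)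
  also have "\<dots> \<le> card {-m..m} + card {0..s - 1}"
    unfolding HK_def VK_def m_def s_def by (intro add_mono card_image_le) auto
  finally show ?thesis using s_pos s_eq by simp
qed

text \<open>Division by \<open>s\<close> with balanced remainder writes \<open>x\<close> as an
  element of H plus an element of V. Neither part can vanish modulo \<open>Q\<close>: otherwise
  \<open>x\<close> would lie in V or in H, contrary to the assumption.\<close>

private lemma I_sum_cover:
  assumes "x mod Q \<notin> I"
  obtains h v where "x = h + v" "h mod Q \<in> I - {0}" "v mod Q \<in> I - {0}"
proof
  \<comment> \<open>Adding \<open>m\<close> before dividing centres the remainder, so that
    \<open>h\<close> falls in \<open>{-m..m}\<close> because \<open>s = 2 * m + 1\<close>.\<close>
  define v where "v = s * ((x + m) div s)"
  define h where "h = x - v"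
  have h: "h + m = (x + m) mod s"
    using minus_mult_div_eq_mod[of "x + m" s] by (simp add: h_def v_def)
  then have "0 \<le> h + m" "h + m < s" using s_pos by simp_all
  then have hm: "h \<in> {-m..m}" using s_eq by simp
  have vs: "s dvd v" by (simp add: v_def)
  show "x = h + v" by (simp add: h_def)
  have "h mod Q \<in> I" "v mod Q \<in> I" using hm vs unfolding mem_I_iff by force+
  moreover have "\<not> Q dvd v"
  proof
    assume "Q dvd v"
    then have "Q dvd x - h" by (simp add: h_def)
    then show False using assms hm unfolding mem_I_iff by blast
  qed
  moreover have "\<not> Q dvd h"
  proof
    assume "Q dvd h"
    then have "s dvd h" unfolding Q_eq by (rule dvd_mult_left)
    then have "s dvd x" using vs by (simp add: h_def dvd_diff_left_iff)
    then show False using assms by (simp add: mem_I_iff)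
  qed
  ultimately show "h mod Q \<in> I - {0}" "v mod Q \<in> I - {0}" by (auto simp: dvd_eq_mod_eq_0)
qed

section \<open>The set R and its sumset\<close>

private lemma mem_R_iff:
  "x \<in> R \<longleftrightarrow> 0 \<le> x \<and> x < q \<and> (Q dvd x \<or> x mod Q \<in> I - {0} \<and> x mod n \<in> Y)"
  by (auto simp: R_def RK_def BK_def q_def Q_def n_def I_def Y_def)

private lemma A_eq: "A = R + {0, q}"
  by (simp add: A_def AK_def R_def q_def)

private lemma finite_R: "finite R"
  by (rule finite_subset[of _ "{0..<q}"]) (auto simp: mem_R_iff)

private lemma finite_A: "finite A"
  by (simp add: A_eq finite_R finite_set_plus)

private lemma exists_R:
  assumes "a mod Q \<in> I - {0}" "y \<in> Y"
  obtains r where "r \<in> R" "Q dvd r - a" "n dvd r - y"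
proof -
  obtain z where z: "[z = a] (mod Q)" "[z = y] (mod n)"
    using binary_chinese_remainder_int[OF coprime_Q_n] by blast
  define r where "r = z mod q"
  have r: "0 \<le> r" "r < q" using q_pos by (auto simp: r_def)
  have "r mod Q = z mod Q" "r mod n = z mod n"
    by (simp_all add: r_def q_eq mod_mod_cancel)
  then have rm: "r mod Q = a mod Q" "r mod n = y mod n" using z by (simp_all add: Cong.cong_def)
  moreover have "y mod n = y" using Y_set_bounds assms(2) by (simp add: Y_def n_eq)
  ultimately have "r \<in> R" using r assms by (simp add: mem_R_iff)
  then show ?thesis using that rm by (simp add: mod_eq_dvd_iff)
qed

text \<open>The fibre of \<open>R\<close> over 0 modulo \<open>Q\<close> is full, so here
  \<open>y\<close> is an arbitrary integer, not restricted to \<open>Y\<close>.\<close>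

private lemma exists_R_0: obtains r where "r \<in> R" "Q dvd r" "n dvd r - y"
proof -
  obtain z where z: "[z = 0] (mod Q)" "[z = y] (mod n)"
    using binary_chinese_remainder_int[OF coprime_Q_n] by blast
  define r where "r = z mod q"
  have r: "0 \<le> r" "r < q" using q_pos by (auto simp: r_def)
  have "r mod Q = z mod Q" "r mod n = z mod n"
    by (simp_all add: r_def q_eq mod_mod_cancel)
  then have rm: "r mod Q = 0" "r mod n = y mod n" using z by (simp_all add: Cong.cong_def)
  then have "r \<in> R" using r by (simp add: mem_R_iff dvd_eq_mod_eq_0)
  then show ?thesis using that rm by (simp add: mod_eq_dvd_iff dvd_eq_mod_eq_0)
qed

text \<open>Three cases. If \<open>Q\<close> divides \<open>x\<close>, then \<open>x\<close> is
  matched by an element of the full fibre plus 0. If \<open>x\<close> is a nonzero class of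
  \<open>I\<close>, some \<open>r\<close> over that class is corrected modulo \<open>n\<close> by an
  element of the full fibre. Otherwise \<open>x\<close> splits into two nonzero classes of
  \<open>I\<close>, and the residue modulo \<open>n\<close> comes from Y + Y.\<close>

private lemma R_sum_cover: "\<exists>r\<in>R. \<exists>r'\<in>R. q dvd x - (r + r')"
proof -
  have *: "\<exists>r\<in>R. \<exists>r'\<in>R. q dvd x - (r + r')"
    if "r \<in> R" "r' \<in> R" "Q dvd x - (r + r')" "n dvd x - (r + r')" for r r'
    using that divides_mult[OF that(3,4) coprime_Q_n] unfolding q_eq by blast
  show ?thesis
  proof (cases "x mod Q \<in> I")
    case True
    show ?thesis
    proof (cases "Q dvd x")
      case True
      obtain r where r: "r \<in> R" "Q dvd r" "n dvd r - x" using exists_R_0 .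
      moreover have "0 \<in> R" using q_pos by (simp add: mem_R_iff)
      ultimately show ?thesis using True by (intro *[of r 0]) (auto simp: dvd_diff_commute)
    next
      case False
      obtain y where y: "y \<in> Y" using Y_set_sum_cover unfolding Y_def by blast
      have "x mod Q \<in> I - {0}" using True False by (auto simp: dvd_eq_mod_eq_0)
      then obtain r where r: "r \<in> R" "Q dvd r - x" "n dvd r - y" using exists_R y by metis
      obtain r' where r': "r' \<in> R" "Q dvd r'" "n dvd r' - (x - r)" using exists_R_0 .
      have "Q dvd (r - x) + r'" using r r' by (intro dvd_add) auto
      moreover have "x - (r + r') = - ((r - x) + r')" "x - (r + r') = - (r' - (x - r))" by simp_all
      ultimately show ?thesis using r(1) r' by (intro *[of r r']) (metis dvd_minus_iff)+
    qed
  next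
    case False
    then obtain h v where hv: "x = h + v" "h mod Q \<in> I - {0}" "v mod Q \<in> I - {0}"
      using I_sum_cover by metis
    obtain y y' where y: "y \<in> Y" "y' \<in> Y" "n dvd x - (y + y')"
      using Y_set_sum_cover unfolding Y_def n_eq by metis
    obtain r where r: "r \<in> R" "Q dvd r - h" "n dvd r - y" using exists_R hv y by metis
    obtain r' where r': "r' \<in> R" "Q dvd r' - v" "n dvd r' - y'" using exists_R hv y by metis
    have "Q dvd (r - h) + (r' - v)" using r r' by (intro dvd_add)
    moreover have "n dvd (x - (y + y')) - ((r - y) + (r' - y'))"
      by (rule dvd_diff[OF y(3) dvd_add[OF r(3) r'(3)]])
    moreover have "x - (r + r') = - ((r - h) + (r' - v))"
      "x - (r + r') = (x - (y + y')) - ((r - y) + (r' - y'))"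
      using hv(1) by linarith+
    ultimately show ?thesis using r(1) r'(1) by (intro *[of r r']) (metis dvd_minus_iff)+
  qed
qed

text \<open>Each class modulo \<open>q\<close> contributes three elements of \<open>A + A\<close>: a
  representative \<open>t\<close> in \<open>R + R\<close> together with \<open>t + q\<close> and
  \<open>t + 2 * q\<close>, available because A = R + {0, q}.\<close>

private lemma card_sumset: "3 * q \<le> int (card (A + A))"
proof -
  have "\<forall>x. \<exists>t. q dvd x - t \<and> t \<in> R + R"
    using R_sum_cover by (meson set_plus_intro)
  then obtain t where t: "\<And>x. q dvd x - t x" "\<And>x. t x \<in> R + R" by metis
  define g where "g = (\<lambda>(x, i). t x + q * i)"
  have "inj_on g ({0..<q} \<times> {0..<3})"
  proof (rule inj_onI, clarify)
    fix x i x' i' assume x: "x \<in> {0..<q}" "x' \<in> {0..<q}" and "g (x, i) = g (x', i')"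
    then have eq: "t x + q * i = t x' + q * i'" by (simp add: g_def)
    have "x - x' = (x - t x) - (x' - t x') + q * (i' - i)" using eq by (simp add: algebra_simps)
    also have "q dvd \<dots>" using t(1) by simp
    finally have "x mod q = x' mod q" by (simp add: mod_eq_dvd_iff)
    then have "x = x'" using x by simp
    then show "x = x' \<and> i = i'" using eq q_pos by simp
  qed
  moreover have "g ` ({0..<q} \<times> {0..<3}) \<subseteq> A + A"
  proof clarify
    fix x i :: int assume i: "i \<in> {0..<3}"
    obtain r r' where r: "t x = r + r'" "r \<in> R" "r' \<in> R"
      using t(2)[of x] by (auto simp: set_plus_def)
    have in_A: "r \<in> A" "r + q \<in> A" if "r \<in> R" for r
      using that set_plus_intro[of r R 0 "{0, q}"] set_plus_intro[of r R q "{0, q}"]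
      by (simp_all add: A_eq)
    have "i = 0 \<or> i = 1 \<or> i = 2" using i by auto
    then have "g (x, i) = r + r' \<or> g (x, i) = (r + q) + r' \<or> g (x, i) = (r + q) + (r' + q)"
      using r by (auto simp: g_def)
    then show "g (x, i) \<in> A + A" using in_A r by (metis set_plus_intro)
  qed
  ultimately have "card ({0..<q} \<times> {0..<3::int}) \<le> card (A + A)"
    using finite_A by (metis card_inj_on_le finite_set_plus)
  then show ?thesis using q_pos by (simp add: card_cartesian_product)
qed

section \<open>Counting A and its differences\<close>

private lemma A_eq_image: "A = (\<lambda>(r, e). r + e) ` (R \<times> {0, q})"
  by (force simp: A_eq set_plus_def)

private lemma card_A_le: "int (card A) \<le> 2 * (n + Q * 6 ^ dK K)"
proof -
  have "R \<subseteq> {x. 0 \<le> x \<and> x < Q * n \<and> x mod Q \<in> {0}} \<union> {x. 0 \<le> x \<and> x < n * Q \<and> x mod n \<in> Y}"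
    (is "_ \<subseteq> ?S \<union> ?T")
    by (auto simp: mem_R_iff q_eq mult.commute)
  moreover have "finite ?S" "finite ?T"
    by (rule finite_subset[of _ "{0..<Q * n}"]; auto simp: mult.commute)+
  ultimately have "card R \<le> card ?S + card ?T"
    by (meson card_Un_le card_mono finite_UnI le_trans)
  moreover have "int (card ?S) \<le> n" using card_residues_le[OF Q_pos n_pos, of "{0}"] by simp
  moreover have "int (card ?T) \<le> int (card Y) * Q"
    using card_residues_le[OF n_pos Q_pos, of Y] card_Y_set by (simp add: Y_def)
  moreover have "int (card Y) \<le> 6 ^ dK K"
    using card_Y_set[of "dK K"] unfolding Y_def by (metis of_nat_le_iff of_nat_numeral of_nat_power)
  then have "int (card Y) * Q \<le> 6 ^ dK K * Q" using Q_pos by simp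
  ultimately have R: "int (card R) \<le> n + Q * 6 ^ dK K" by (simp add: mult.commute)
  have "card A \<le> card (R \<times> {0, q})"
    unfolding A_eq_image using finite_R by (intro card_image_le) simp
  then show ?thesis using R q_pos by (simp add: card_cartesian_product)
qed

private lemma card_A_ge: "2 * n \<le> int (card A)"
proof -
  have "(\<lambda>i. Q * i) ` {0..<2 * n} \<subseteq> A"
  proof clarify
    fix i assume i: "i \<in> {0..<2 * n}"
    show "Q * i \<in> A"
    proof (cases "i < n")
      case True
      then have "Q * i \<in> R" using i Q_pos by (simp add: mem_R_iff q_eq)
      then show ?thesis using set_plus_intro[of "Q * i" R 0 "{0, q}"] by (simp add: A_eq)
    next
      case False
      then have "Q * (i - n) \<in> R" using i Q_pos by (simp add: mem_R_iff q_eq)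
      then have "Q * (i - n) + q \<in> A" unfolding A_eq by (intro set_plus_intro) simp_all
      then show ?thesis by (simp add: q_eq algebra_simps)
    qed
  qed
  moreover have "inj_on (\<lambda>i. Q * i) {0..<2 * n}" using Q_pos by (simp add: inj_on_def)
  ultimately have "card {0..<2 * n} \<le> card A"
    using finite_A by (metis card_inj_on_le)
  then show ?thesis using n_pos by simp
qed

text \<open>If one term is a multiple of \<open>Q\<close>, the difference is congruent to plus or
  minus the other one, and \<open>I\<close> is symmetric. Otherwise both terms have their residue
  modulo \<open>n\<close> in \<open>Y\<close>.\<close>

private lemma mod_diff_A_cases:
  assumes "a \<in> A" "a' \<in> A"
  shows "(a - a') mod Q \<in> I \<or> (a - a') mod n \<in> (\<lambda>x. x mod n) ` diffset Y"
proof -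
  have *: "Q dvd a \<or> a mod Q \<in> I \<and> a mod n \<in> Y" if a: "a \<in> A" for a
  proof -
    obtain r where r: "r \<in> R" "a = r \<or> a = r + q" using a by (auto simp: A_eq set_plus_def)
    then have "a mod Q = r mod Q" "a mod n = r mod n" by (auto simp: q_eq)
    then show ?thesis using r(1) by (auto simp: mem_R_iff dvd_eq_mod_eq_0)
  qed
  have 0: "0 mod Q \<in> I" by (simp only: mem_I_iff) simp
  consider "Q dvd a'" | "Q dvd a" | "a mod n \<in> Y" "a' mod n \<in> Y"
    using *[OF assms(1)] *[OF assms(2)] by blast
  then show ?thesis
  proof cases
    case 1
    then have "(a - a') mod Q = a mod Q" by (simp add: mod_eq_dvd_iff)
    moreover have "a mod Q \<in> I" using *[OF assms(1)] 0 by (auto simp: dvd_eq_mod_eq_0)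
    ultimately show ?thesis by simp
  next
    case 2
    then have "(a - a') mod Q = (- a') mod Q" by (simp add: mod_eq_dvd_iff)
    moreover have "a' mod Q \<in> I" using *[OF assms(2)] 0 by (auto simp: dvd_eq_mod_eq_0)
    ultimately show ?thesis using I_uminus by simp
  next
    case 3
    then have "a mod n - a' mod n \<in> diffset Y" by (auto simp: diffset_def)
    moreover have "(a - a') mod n = (a mod n - a' mod n) mod n" by (simp add: mod_diff_eq)
    ultimately show ?thesis by blast
  qed
qed

private lemma card_diffset_le:
  "int (card (diffset A)) \<le> 4 * (2 * s * n + Q * int (card ((\<lambda>x. x mod n) ` diffset Y)))"
proof -
  let ?D = "(\<lambda>x. x mod n) ` diffset Y"
  let ?S = "{x. 0 \<le> x \<and> x < Q * n \<and> x mod Q \<in> I}"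
  let ?T = "{x. 0 \<le> x \<and> x < n * Q \<and> x mod n \<in> ?D}"
  have finD: "finite ?D" by (rule finite_subset[of _ "{0..<n}"]) (auto simp: n_pos)
  have fin: "finite ?S" "finite ?T"
    by (rule finite_subset[of _ "{0..<Q * n}"]; auto simp: mult.commute)+
  have "diffset A \<subseteq> (\<lambda>(x, i). x + q * i) ` ((?S \<union> ?T) \<times> {-2..1})"
  proof
    fix u assume "u \<in> diffset A"
    then obtain a a' where a: "u = a - a'" "a \<in> A" "a' \<in> A" by (auto simp: diffset_def)
    have b: "0 \<le> a \<and> a < 2 * q" if "a \<in> A" for a
      using that q_pos by (auto simp: A_eq set_plus_def mem_R_iff)
    \<comment> \<open>Differences lie in [-2q, 2q), which is four blocks of length \<open>q\<close>;
      hence the factor 4.\<close>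
    have "u < q * 2" "- 2 * q \<le> u" using a b[OF a(2)] b[OF a(3)] by linarith+
    then have "u div q < 2" "- 2 * q div q \<le> u div q"
      using q_pos by (auto intro: div_less_of_less_mult zdiv_mono1)
    moreover have "- 2 * q div q = - 2"
      using q_pos by (intro nonzero_mult_div_cancel_right) simp
    ultimately have "u div q \<in> {-2..1}" by simp
    moreover have "u mod q \<in> ?S \<union> ?T"
    proof -
      have "u mod q mod Q = u mod Q" "u mod q mod n = u mod n"
        by (simp_all add: q_eq mod_mod_cancel)
      moreover have "0 \<le> u mod q" "u mod q < Q * n" "u mod q < n * Q"
        using q_pos by (simp_all add: q_eq mult.commute)
      ultimately show ?thesis using mod_diff_A_cases[OF a(2,3)] a(1) by auto
    qed
    moreover have "u = u mod q + q * (u div q)" by simp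
    ultimately show "u \<in> (\<lambda>(x, i). x + q * i) ` ((?S \<union> ?T) \<times> {-2..1})"
      by (intro image_eqI[of _ _ "(u mod q, u div q)"]) auto
  qed
  then have "card (diffset A) \<le> card ((?S \<union> ?T) \<times> {-2..1::int})"
    using fin by (intro surj_card_le) auto
  then have "card (diffset A) \<le> card (?S \<union> ?T) * 4"
    by (simp add: card_cartesian_product)
  moreover have "card (?S \<union> ?T) \<le> card ?S + card ?T" by (rule card_Un_le)
  moreover have "int (card ?S) \<le> int (card I) * n"
    by (rule card_residues_le[OF Q_pos n_pos finite_I])
  moreover have "int (card I) * n \<le> 2 * s * n" using card_I n_pos by simp
  moreover have "int (card ?T) \<le> int (card ?D) * Q"
    by (rule card_residues_le[OF n_pos Q_pos finD])
  ultimately show ?thesis by (simp add: mult.commute)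
qed

section \<open>Bounds for sigma and delta\<close>

private lemma sigma_gt: "sigma A > 4 ^ K"
proof -
  have "Q \<le> 2 ^ (2 * K + 2)"
  proof -
    have "s \<le> 2 ^ (K + 1)" by (simp add: s_def sK_def)
    then have "s * s \<le> 2 ^ (K + 1) * 2 ^ (K + 1)" using s_pos by (intro mult_mono) auto
    also have "\<dots> = 2 ^ (2 * K + 2)"
      unfolding power_add[symmetric] by (rule arg_cong[where f = "\<lambda>i. 2 ^ i"]) simp
    finally show ?thesis by (simp only: Q_eq)
  qed
  \<comment> \<open>Since \<open>dK K\<close> exceeds 2K + 3, the \<open>Q * 6 ^ dK K\<close>
    possible elements outside the multiples of \<open>Q\<close> number at most n / 2. Thus A has at
    most 3n elements, to be compared with 3Qn in the sumset.\<close>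
  then have "2 * Q \<le> 2 ^ (2 * K + 3)" by (simp add: power_add)
  also have "\<dots> \<le> (2::int) ^ dK K" by (intro power_increasing) (auto simp: dK_def)
  finally have "2 * Q * 6 ^ dK K \<le> 2 ^ dK K * 6 ^ dK K" by (intro mult_right_mono) auto
  also have "\<dots> = n" by (simp add: n_eq flip: power_mult_distrib)
  finally have "2 * (Q * 6 ^ dK K) \<le> n" by (simp only: mult.assoc)
  then have A3: "int (card A) \<le> 3 * n" using card_A_le unfolding distrib_left by linarith
  have "(2::int) ^ K * 2 ^ K < s * s"
    by (intro mult_strict_mono) (auto simp: s_def sK_def)
  then have "4 ^ K < Q" by (simp add: Q_eq flip: power_mult_distrib)
  then have "4 ^ K * int (card A) < Q * int (card A)"
    using card_A_ge n_pos by (intro mult_strict_right_mono) auto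
  also have "\<dots> \<le> Q * (3 * n)" using A3 Q_pos by simp
  also have "\<dots> \<le> int (card (A + A))" using card_sumset by (simp add: q_eq)
  finally have "real_of_int (4 ^ K * int (card A)) < real_of_int (int (card (A + A)))"
    by (simp only: of_int_less_iff)
  then show ?thesis using card_A_ge n_pos by (simp add: sigma_def pos_less_divide_eq)
qed

text \<open>Here 93 / 8 = 12 * 31 / 32, and 22 is the least exponent for which the power of 31 / 32
  drops below 1 / 2. Hence \<open>dK K\<close> = 22 (K + 2) gains the factor
  \<open>2 ^ (K + 2)\<close>.\<close>

private lemma card_diffset_Y_mod:
  "real (card ((\<lambda>x. x mod n) ` diffset Y)) * 2 ^ (K + 2) \<le> real_of_int n"
proof -
  have "real (card ((\<lambda>x. x mod n) ` diffset Y)) \<le> (93 / 8) ^ dK K"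
    unfolding n_eq Y_def by (rule card_diffset_Y_set_mod)
  also have "\<dots> = 12 ^ dK K * ((31 / 32) ^ 22) ^ (K + 2)"
    unfolding dK_def power_mult[symmetric] power_mult_distrib[symmetric] by simp
  also have "\<dots> \<le> 12 ^ dK K * (1 / 2) ^ (K + 2)"
    by (intro mult_left_mono power_mono) (auto simp: power_divide)
  finally show ?thesis by (simp add: n_eq power_divide field_simps)
qed

text \<open>With P = \<open>2 ^ K\<close>, the full fibres contribute at most 8 (P + 1) n and the
  remaining ones at most 2 P n. For P \<ge> 4 the total is at most 12 P n, below 8 P times the 2n
  elements guaranteed in \<open>A\<close>.\<close>

private lemma delta_lt: "delta A < 2 ^ (K + 3)"
proof -
  define \<eta> where "\<eta> = real (card ((\<lambda>x. x mod n) ` diffset Y))"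
  define P :: real where "P = 2 ^ K"
  have P: "P \<ge> 4"
  proof -
    have "K \<ge> 2" using K_pos K_even by presburger
    then have "(2::real) ^ 2 \<le> 2 ^ K" by (intro power_increasing) auto
    then show ?thesis by (simp add: P_def)
  qed
  have s: "real_of_int s = P + 1" by (simp add: s_def sK_def P_def)
  have \<eta>: "\<eta> * (4 * P) \<le> real_of_int n"
    using card_diffset_Y_mod by (simp add: \<eta>_def P_def mult_ac)
  have "real (card (diffset A)) \<le> 4 * (2 * (P + 1) * real_of_int n + (P + 1)\<^sup>2 * \<eta>)"
  proof -
    have "real_of_int (int (card (diffset A)))
        \<le> real_of_int (4 * (2 * s * n + Q * int (card ((\<lambda>x. x mod n) ` diffset Y))))"
      using card_diffset_le by (simp only: of_int_le_iff)
    also have "\<dots> = 4 * (2 * (P + 1) * real_of_int n + (P + 1)\<^sup>2 * \<eta>)"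
      by (simp only: of_int_mult of_int_add of_int_numeral of_int_of_nat_eq s Q_eq \<eta>_def power2_eq_square)
    finally show ?thesis by simp
  qed
  also have "\<dots> < 8 * P * (2 * real_of_int n)"
  proof -
    have "4 * P \<le> P * P" using P by simp
    then have "(P + 1)\<^sup>2 \<le> 2 * P * P"
      using P unfolding power2_eq_square by (simp only: distrib_left distrib_right)
    then have "(P + 1)\<^sup>2 * \<eta> \<le> 2 * P * P * \<eta>" by (intro mult_right_mono) (auto simp: \<eta>_def)
    also have "\<dots> = P * (\<eta> * (4 * P)) / 2" by simp
    also have "\<dots> \<le> P * real_of_int n / 2"
      using P by (intro divide_right_mono mult_left_mono \<eta>) auto
    finally have 1: "(P + 1)\<^sup>2 * \<eta> \<le> P * real_of_int n / 2" .
    have "2 * real_of_int n \<le> P * real_of_int n / 2" using P n_pos by simp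
    moreover have "0 < P * real_of_int n" using P n_pos by simp
    ultimately show ?thesis using 1 by (simp add: algebra_simps)
  qed
  also have "\<dots> \<le> 8 * P * real (card A)"
  proof -
    have "real_of_int (2 * n) \<le> real_of_int (int (card A))" using card_A_ge by (simp only: of_int_le_iff)
    then show ?thesis using P by (intro mult_left_mono) auto
  qed
  finally show ?thesis
    using card_A_ge n_pos by (simp add: delta_def P_def power_add pos_divide_less_eq mult_ac)
qed

lemma C_exp_AK_gt: "C_exp (AK K) > 2 * real K / (real K + 3)"
proof -
  have "A \<noteq> {}" using card_A_ge n_pos by auto
  then have s2: "sigma A \<le> (delta A)\<^sup>2" and d1: "delta A \<ge> 1"
    using finite_A by (auto intro: sigma_le_delta_square delta_ge_1)
  have "(1::real) < 4 ^ K" using K_pos by simp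
  \<comment> \<open>A value \<open>delta A\<close> = 1 would force \<open>sigma A\<close> \<le> 1;
    excluding it makes the denominator of \<open>C_exp\<close> positive.\<close>
  then have "delta A \<noteq> 1" using s2 sigma_gt by auto
  then have d: "0 < ln (delta A)" using d1 by simp
  have "ln (delta A) < ln (2 ^ (K + 3))" using delta_lt d1 by simp
  then have ld: "ln (delta A) < (real K + 3) * ln 2" by (simp add: ln_realpow)
  have "ln (4 ^ K) < ln (sigma A)" using sigma_gt by (subst ln_less_cancel_iff) (auto intro: less_trans[rotated])
  moreover have "ln (4 ^ K :: real) = 2 * real K * ln 2"
    using ln_realpow[of 2 "2 * K"] by (simp add: power_mult)
  ultimately have ls: "2 * real K * ln 2 < ln (sigma A)" by simp
  have "2 * real K / (real K + 3) = 2 * real K * ln 2 / ((real K + 3) * ln 2)" by simp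
  also have "\<dots> < ln (sigma A) / ((real K + 3) * ln 2)"
    using ls by (intro divide_strict_right_mono) auto
  also have "\<dots> \<le> ln (sigma A) / ln (delta A)"
  proof (intro divide_left_mono)
    have "0 \<le> 2 * real K * ln 2" by simp
    then show "0 \<le> ln (sigma A)" using ls by linarith
  qed (use ld d in \<open>auto intro!: mult_pos_pos\<close>)
  finally show ?thesis by (simp add: C_exp_def A_def)
qed

end

section \<open>Optimality of the exponent 2\<close>

lemma C_exp_le_universal_exponent:
  assumes "universal_exponent c" "finite A" "card A \<ge> 2" "C_exp A > 0"
  shows "C_exp A \<le> c"
proof -
  have "A \<noteq> {}" using assms by auto
  then have d: "delta A \<ge> 1" using assms(2) delta_ge_1 by blast
  then have "ln (delta A) \<ge> 0" by simp
  \<comment> \<open>A zero denominator would give \<open>C_exp A\<close> the default value 0, so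
    positivity of \<open>C_exp A\<close> forces both logarithms to be positive.\<close>
  then have lpos: "ln (delta A) > 0" "ln (sigma A) > 0"
    using assms(4) by (auto simp: C_exp_def zero_less_divide_iff)
  have le: "sigma A \<le> delta A powr c" using assms by (simp add: universal_exponent_def)
  \<comment> \<open>As \<open>ln 0 = 0\<close>, a positive logarithm rules out
    \<open>sigma A\<close> = 0.\<close>
  moreover have "sigma A > 0"
    using lpos(2) by (metis divide_nonneg_nonneg less_irrefl ln_0 of_nat_0_le_iff order_le_less sigma_def)
  ultimately have "ln (sigma A) \<le> ln (delta A powr c)"
    using d by (subst ln_le_cancel_iff) auto
  also have "\<dots> = c * ln (delta A)" using d by (simp add: ln_powr)
  finally show ?thesis using lpos by (simp add: C_exp_def pos_divide_le_eq)
qed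

lemma universal_exponent_ge_2:
  assumes "universal_exponent c"
  shows "2 \<le> c"
proof (rule LIMSEQ_le_const2)
  \<comment> \<open>The sequence runs through K = 2 (k + 1), so every term is a bound for a positive
    even \<open>K\<close>.\<close>
  show "(\<lambda>k. 2 * real (2 * Suc k) / (real (2 * Suc k) + 3)) \<longlonglongrightarrow> 2"
    by real_asymp
  have "2 * real K / (real K + 3) \<le> c" if "0 < K" "even K" for K
  proof -
    have gt: "C_exp (AK K) > 2 * real K / (real K + 3)" using C_exp_AK_gt that .
    moreover have "2 * real K / (real K + 3) \<ge> 0" by simp
    ultimately have "C_exp (AK K) > 0" by linarith
    then show ?thesis
      using gt C_exp_le_universal_exponent[OF assms finite_AK card_AK_ge_2] by fastforce
  qed
  then show "\<exists>N. \<forall>k\<ge>N. 2 * real (2 * Suc k) / (real (2 * Suc k) + 3) \<le> c"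
    by (metis even_mult_iff even_numeral nat_0_less_mult_iff zero_less_Suc zero_less_numeral)
qed

theorem theorem1p1:
  "(\<forall>K::nat. 0 < K \<and> even K \<longrightarrow> C_exp (AK K) > 2 * real K / (real K + 3)) \<and>
   (universal_exponent 2 \<and> (\<forall>c. universal_exponent c \<longrightarrow> 2 \<le> c))"
  using C_exp_AK_gt universal_exponent_2 universal_exponent_ge_2 by blast

end
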